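(* There is an absolute constant $c>0$ such that for every sufficiently large positive integer $n$ there exists an acyclic digraph $D$ on $n$ vertices whose underlying undirected graph is $3$-degenerate and such that \[ \vec{r}(D) \geq n^{c\frac{\log n}{\log \log n}}. \]
   Context: For an acyclic digraph $D$, the oriented Ramsey number $\vec{r}(D)$ is the minimum integer $N$ such that every tournament on $N$ vertices contains a copy of $D$. A graph is $3$-degenerate if every subgraph has a vertex of degree at most $3$. Logarithms are natural. *)

theory Defs
  imports Complex_Main "Graph_Theory.Digraph_Component" "Graph_Theory.Digraph_Isomorphism"
begin

definition tournament :: "'a pair_pre_digraph \<Rightarrow> bool" where
  "tournament T \<longleftrightarrow> pair_digraph T \<and>
     (\<forall>u \<in> pverts T. \<forall>v \<in> pverts T. u \<noteq> v \<longrightarrow>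
        ((u, v) \<in> parcs T \<longleftrightarrow> (v, u) \<notin> parcs T))"

text \<open>A copy need not be induced.\<close>
definition contains_copy :: "('c, 'd) pre_digraph \<Rightarrow> ('a, 'b) pre_digraph \<Rightarrow> bool" where
  "contains_copy H G \<longleftrightarrow> (\<exists>K. subgraph K G \<and> digraph_iso H K)"

text \<open>
  Tournaments are taken with vertices in \<^typ>\<open>nat\<close>, which covers all finite tournaments up to
  isomorphism. The minimum exists whenever \<open>D\<close> is finite and acyclic; see
  \<open>oriented_ramsey_exists\<close> below.
\<close>
definition oriented_ramsey :: "'a pair_pre_digraph \<Rightarrow> nat" where
  "oriented_ramsey D =
     (LEAST N. \<forall>T :: nat pair_pre_digraph.
        tournament T \<and> card (pverts T) = N \<longrightarrow> contains_copy (with_proj D) (with_proj T))"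

text \<open>
  Undirected graphs are symmetric digraphs, so only symmetric subgraphs count and the degree of a
  vertex is its out-degree. The empty subgraph is excluded, as usual.
\<close>
definition degenerate :: "nat \<Rightarrow> ('a, 'b) pre_digraph \<Rightarrow> bool" where
  "degenerate k G \<longleftrightarrow>
     (\<forall>H. subgraph H G \<and> symmetric H \<and> verts H \<noteq> {} \<longrightarrow> (\<exists>v \<in> verts H. out_degree H v \<le> k))"

lemma contains_copy_pair_iff:
  assumes D: "pair_wf_digraph D" and T: "pair_wf_digraph T"
  shows "contains_copy (with_proj D) (with_proj T) \<longleftrightarrow>
    (\<exists>f. inj_on f (pverts D) \<and> f ` pverts D \<subseteq> pverts T \<and>
         (\<forall>(u, v) \<in> parcs D. (f u, f v) \<in> parcs T))"
    (is "?L \<longleftrightarrow> ?R")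
proof
  assume ?L
  then obtain h where sub: "subgraph (app_iso h (with_proj D)) (with_proj T)"
    and iso: "pre_digraph.digraph_isomorphism (with_proj D) h"
    by (auto simp: contains_copy_def digraph_iso_def)
  have th: "iso_tail h = fst" "iso_head h = snd"
    using sub by (auto simp: subgraph_def compatible_def app_iso_def)
  have "(iso_verts h u, iso_verts h v) \<in> parcs T" if "(u, v) \<in> parcs D" for u v
  proof -
    have "iso_verts h u = fst (iso_arcs h (u, v))" "iso_verts h v = snd (iso_arcs h (u, v))"
      using iso that th by (auto simp: pre_digraph.digraph_isomorphism_def)
    moreover have "iso_arcs h (u, v) \<in> parcs T"
      using sub that by (auto simp: subgraph_def app_iso_def)
    ultimately show ?thesis by simp
  qed
  moreover have "inj_on (iso_verts h) (pverts D)"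
    using iso by (auto simp: pre_digraph.digraph_isomorphism_def)
  moreover have "iso_verts h ` pverts D \<subseteq> pverts T"
    using sub by (auto simp: subgraph_def app_iso_def)
  ultimately show ?R by blast
next
  assume ?R
  then obtain f where inj: "inj_on f (pverts D)" and V: "f ` pverts D \<subseteq> pverts T"
    and A: "\<And>u v. (u, v) \<in> parcs D \<Longrightarrow> (f u, f v) \<in> parcs T"
    by fast
  interpret D: pair_wf_digraph D by (rule D)
  interpret T: pair_wf_digraph T by (rule T)
  define h where "h = \<lparr>iso_verts = f, iso_arcs = map_prod f f, iso_head = snd, iso_tail = fst\<rparr>"
  have inj': "inj_on (map_prod f f) (parcs D)"
    by (rule inj_on_subset[OF map_prod_inj_on[OF inj inj]]) (auto dest: D.in_arcsD1 D.in_arcsD2)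
  have "pre_digraph.digraph_isomorphism (with_proj D) h"
    using inj inj' D.wf_digraph by (auto simp: pre_digraph.digraph_isomorphism_def h_def)
  moreover have "subgraph (app_iso h (with_proj D)) (with_proj T)"
    using V A T.wf_digraph
    by (auto simp: subgraph_def compatible_def app_iso_def h_def wf_digraph_def
        dest: D.in_arcsD1 D.in_arcsD2)
  ultimately show ?L
    unfolding contains_copy_def digraph_iso_def by blast
qed

lemma acyclic_embeds:
  fixes A :: "'a rel" and R :: "'b rel"
  assumes "finite V" "acyclic A" "A \<subseteq> V \<times> V" "finite W" "2 ^ card V \<le> card W"
    and "\<And>u v. u \<in> W \<Longrightarrow> v \<in> W \<Longrightarrow> u \<noteq> v \<Longrightarrow> (u, v) \<in> R \<or> (v, u) \<in> R"
  shows "\<exists>f. inj_on f V \<and> f ` V \<subseteq> W \<and> (\<forall>(u, v) \<in> A. (f u, f v) \<in> R)"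
  using assms
proof (induction "card V" arbitrary: V A W)
  case 0
  then show ?case by auto
next
  case (Suc n)
  have finA: "finite A"
    using Suc.prems by (meson finite_SigmaI finite_subset)
  from Suc.hyps obtain x0 where x0: "x0 \<in> V"
    by (metis card.empty equals0I nat.distinct(1))
  have "wf A" using finA Suc.prems(2) by (rule finite_acyclic_wf)
  then obtain s where s: "s \<in> V" "\<And>y. (y, s) \<notin> A"
    using x0 Suc.prems(3) by (elim wfE_min) blast+
  have "wf (A\<inverse>)" using finA Suc.prems(2) by (rule finite_acyclic_wf_converse)
  then obtain t where t: "t \<in> V" "\<And>y. (t, y) \<notin> A"
    using x0 Suc.prems(3) by (elim wfE_min) blast+
  have cW: "2 * 2 ^ n \<le> card W" using Suc.prems(5) Suc.hyps(2) by (metis power_Suc)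
  then have "W \<noteq> {}" by auto
  then obtain w where w: "w \<in> W" by blast
  define Out where "Out = {y \<in> W - {w}. (w, y) \<in> R}"
  define In where "In = {y \<in> W - {w}. (y, w) \<in> R}"
  have "W - {w} \<subseteq> Out \<union> In" using Suc.prems(6) w by (auto simp: Out_def In_def)
  then have "card (W - {w}) \<le> card (Out \<union> In)"
    using Suc.prems(4) by (intro card_mono) (auto simp: Out_def In_def)
  also have "\<dots> \<le> card Out + card In" by (rule card_Un_le)
  finally have "card W \<le> Suc (card Out + card In)"
    using w Suc.prems(4) by simp
  then have large: "2 ^ n \<le> card Out \<or> 2 ^ n \<le> card In"
    using cW by linarith
  have extend: "\<exists>f. inj_on f V \<and> f ` V \<subseteq> W \<and> (\<forall>(u, v) \<in> A. (f u, f v) \<in> R)"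
    if X: "X \<subseteq> W - {w}" "2 ^ n \<le> card X" and x: "x \<in> V"
      and xs: "(\<forall>y. (y, x) \<notin> A) \<and> (\<forall>y \<in> X. (w, y) \<in> R) \<or> (\<forall>y. (x, y) \<notin> A) \<and> (\<forall>y \<in> X. (y, w) \<in> R)"
    for X x
  proof -
    let ?V = "V - {x}" and ?A = "A \<inter> ((V - {x}) \<times> (V - {x}))"
    have c: "n = card ?V" using Suc.hyps(2) x Suc.prems(1) by simp
    have "\<exists>f. inj_on f ?V \<and> f ` ?V \<subseteq> X \<and> (\<forall>(u, v) \<in> ?A. (f u, f v) \<in> R)"
    proof (rule Suc.hyps(1)[OF c])
      show "acyclic ?A" using Suc.prems(2) by (rule acyclic_subset) auto
      show "finite X" using X(1) Suc.prems(4) by (meson finite_Diff finite_subset)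
      show "2 ^ card ?V \<le> card X" using X(2) c by simp
      show "(u, v) \<in> R \<or> (v, u) \<in> R" if "u \<in> X" "v \<in> X" "u \<noteq> v" for u v
        using that X(1) Suc.prems(6) by blast
    qed (use Suc.prems in auto)
    then obtain f where f: "inj_on f ?V" "f ` ?V \<subseteq> X"
      and fA: "\<And>u v. (u, v) \<in> A \<Longrightarrow> u \<in> ?V \<Longrightarrow> v \<in> ?V \<Longrightarrow> (f u, f v) \<in> R"
      by fast
    let ?f = "f(x := w)"
    have "inj_on ?f V"
      using f X(1) by (auto simp: inj_on_def)
    moreover have "?f ` V \<subseteq> W" using f X(1) w by auto
    moreover have "(?f u, ?f v) \<in> R" if uv: "(u, v) \<in> A" for u v
    proof -
      have "u \<in> V" "v \<in> V" using uv Suc.prems(3) by auto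
      moreover have "u \<noteq> v" using uv Suc.prems(2) by (auto simp: acyclic_def)
      ultimately show ?thesis using xs fA[OF uv] f(2) uv by auto
    qed
    ultimately show ?thesis by blast
  qed
  have "Out \<subseteq> W - {w}" "\<forall>y \<in> Out. (w, y) \<in> R" "In \<subseteq> W - {w}" "\<forall>y \<in> In. (y, w) \<in> R"
    by (auto simp: Out_def In_def)
  with large show ?case
    using extend[of Out s] extend[of In t] s t by meson
qed

lemma oriented_ramsey_exists:
  fixes D :: "'a pair_pre_digraph"
  assumes "pair_digraph D" "acyclic (parcs D)"
  shows "\<exists>N. \<forall>T :: nat pair_pre_digraph.
    tournament T \<and> card (pverts T) = N \<longrightarrow> contains_copy (with_proj D) (with_proj T)"
proof (intro exI allI impI)
  fix T :: "nat pair_pre_digraph"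
  assume "tournament T \<and> card (pverts T) = 2 ^ card (pverts D)"
  then have T: "pair_digraph T" "card (pverts T) = 2 ^ card (pverts D)"
    "\<And>u v. u \<in> pverts T \<Longrightarrow> v \<in> pverts T \<Longrightarrow> u \<noteq> v \<Longrightarrow> (u, v) \<in> parcs T \<or> (v, u) \<in> parcs T"
    unfolding tournament_def by blast+
  interpret D: pair_digraph D by fact
  interpret T: pair_digraph T by fact
  show "contains_copy (with_proj D) (with_proj T)"
    unfolding contains_copy_pair_iff[OF D.pair_wf_digraph_axioms T.pair_wf_digraph_axioms]
    by (rule acyclic_embeds[OF D.pair_finite_verts assms(2) _ T.pair_finite_verts _ T(3)])
      (use T(2) in \<open>auto dest: D.in_arcsD1 D.in_arcsD2\<close>)
qed

end

theory Submission
  imports Defs "HOL-Real_Asymp.Real_Asymp"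
begin

text \<open>
  Take \<open>h\<close> hubs \<open>0, \<dots>, h - 1\<close> and, for all \<open>i < j, k\<close>, a leaf \<open>v\<close> with \<open>i \<rightarrow> v \<rightarrow> j, k\<close>. The hubs are
  independent and leaves have degree at most 3, so this digraph is 3-degenerate. The host is the
  \<open>K\<close>-fold lexicographic power of a tournament \<open>R\<close> on \<open>2^s\<close> vertices without transitive
  subtournaments on more than \<open>2s + 1\<close> vertices. In a copy, the parts of the top level of the power
  that contain at least two hubs are transitively ordered by their first hubs, so there are at most
  \<open>2s + 1\<close> of them, and each is handled recursively; all other parts together contain at most
  \<open>2^s\<close> hubs. Hence \<open>h \<le> 2^s (2s + 2)^K\<close>, whereas the host has \<open>2^(sK)\<close> vertices. Choosing
  \<open>s \<approx> log n / 8\<close> and \<open>K \<approx> log n / (8 log log n)\<close> contradicts \<open>h > n^(1/4)\<close>.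
\<close>

section \<open>Tournament relations\<close>

text \<open>The case \<open>u = v\<close> yields irreflexivity. Nothing is demanded of pairs outside
  \<open>B\<close>, so \<open>lex R\<close>, a relation on all lists, can be restricted to words of
  one length.\<close>

definition tournament_on :: "'a set \<Rightarrow> 'a rel \<Rightarrow> bool" where
  "tournament_on B R \<longleftrightarrow> (\<forall>u\<in>B. \<forall>v\<in>B. (u, v) \<in> R \<longleftrightarrow> u \<noteq> v \<and> (v, u) \<notin> R)"

lemma tournament_onD:
  "tournament_on B R \<Longrightarrow> u \<in> B \<Longrightarrow> v \<in> B \<Longrightarrow> (u, v) \<in> R \<longleftrightarrow> u \<noteq> v \<and> (v, u) \<notin> R"
  unfolding tournament_on_def by blast

lemma tournament_on_asym:
  "tournament_on B R \<Longrightarrow> u \<in> B \<Longrightarrow> v \<in> B \<Longrightarrow> (u, v) \<in> R \<Longrightarrow> (v, u) \<notin> R"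
  unfolding tournament_on_def by blast

lemma tournament_on_irrefl: "tournament_on B R \<Longrightarrow> u \<in> B \<Longrightarrow> (u, u) \<notin> R"
  unfolding tournament_on_def by blast

text \<open>On words of length \<open>K\<close>, \<open>lex R\<close> is the \<open>K\<close>-fold
  lexicographic power of \<open>R\<close>: the first differing letter decides the direction.\<close>

lemma tournament_on_lex:
  assumes "tournament_on B R"
  shows "tournament_on {xs. set xs \<subseteq> B \<and> length xs = K} (lex R)"
proof (induction K)
  case 0
  then show ?case by (auto simp: tournament_on_def)
next
  case (Suc K)
  show ?case
    unfolding tournament_on_def
  proof (intro ballI)
    fix us vs
    assume u: "us \<in> {xs. set xs \<subseteq> B \<and> length xs = Suc K}"
      and v: "vs \<in> {xs. set xs \<subseteq> B \<and> length xs = Suc K}"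
    obtain x xs where us: "us = x # xs" using u by (cases us) auto
    obtain y ys where vs: "vs = y # ys" using v by (cases vs) auto
    have xy: "(x, y) \<in> R \<longleftrightarrow> x \<noteq> y \<and> (y, x) \<notin> R"
      by (rule tournament_onD[OF assms]) (use u v us vs in auto)
    have "(xs, ys) \<in> lex R \<longleftrightarrow> xs \<noteq> ys \<and> (ys, xs) \<notin> lex R"
      by (rule tournament_onD[OF Suc.IH]) (use u v us vs in auto)
    with xy show "(us, vs) \<in> lex R \<longleftrightarrow> us \<noteq> vs \<and> (vs, us) \<notin> lex R"
      using u v us vs by (simp, blast)
  qed
qed

text \<open>\<open>oriented_ramsey\<close> speaks of tournaments with exactly \<open>N\<close>
  vertices of type \<open>nat\<close>. If \<open>N\<close> were at most \<open>card W\<close>, some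
  \<open>N\<close> vertices of \<open>W\<close>, relabelled by \<open>{0..<N}\<close>, would have to
  contain \<open>D\<close>; acyclicity of \<open>D\<close> ensures that the minimum is
  attained.\<close>

lemma oriented_ramsey_greater:
  fixes D :: "'a pair_pre_digraph" and W :: "'b set"
  assumes D: "pair_digraph D" "acyclic (parcs D)"
    and W: "finite W" "tournament_on W Q"
    and no: "\<And>f. inj_on f (pverts D) \<Longrightarrow> f ` pverts D \<subseteq> W \<Longrightarrow>
      (\<And>u v. (u, v) \<in> parcs D \<Longrightarrow> (f u, f v) \<in> Q) \<Longrightarrow> False"
  shows "card W < oriented_ramsey D"
proof (rule ccontr)
  define N where "N = oriented_ramsey D"
  assume "\<not> card W < oriented_ramsey D"
  then have "N \<le> card W" by (simp add: N_def)
  then obtain W' where W': "W' \<subseteq> W" "card W' = N"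
    by (meson obtain_subset_with_card_n)
  have finW': "finite W'" using W' W(1) finite_subset by blast
  obtain e where e: "bij_betw e {0..<N} W'"
    using ex_bij_betw_nat_finite[OF finW'] W' by auto
  define T where "T = \<lparr>pverts = {0..<N}, parcs = {(i, j). i < N \<and> j < N \<and> (e i, e j) \<in> Q}\<rparr>"
  have eW: "e i \<in> W" if "i < N" for i
    using e W'(1) that by (auto simp: bij_betw_def)
  have e_inj: "e i = e j \<longleftrightarrow> i = j" if "i < N" "j < N" for i j
    using e that by (auto simp: bij_betw_def inj_on_def)
  have "finite (parcs T)"
    by (rule finite_subset[of _ "{0..<N} \<times> {0..<N}"]) (auto simp: T_def)
  then have T: "pair_digraph T"
    using eW tournament_on_irrefl[OF W(2)] by unfold_locales (auto simp: T_def)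
  have "tournament T"
    unfolding tournament_def
  proof (intro conjI ballI impI T)
    fix i j assume ij: "i \<in> pverts T" "j \<in> pverts T" "i \<noteq> j"
    then have "(e i, e j) \<in> Q \<longleftrightarrow> e i \<noteq> e j \<and> (e j, e i) \<notin> Q"
      by (intro tournament_onD[OF W(2)] eW) (simp_all add: T_def)
    moreover have "e i \<noteq> e j" using ij e_inj by (simp add: T_def)
    ultimately show "(i, j) \<in> parcs T \<longleftrightarrow> (j, i) \<notin> parcs T" using ij by (simp add: T_def)
  qed
  moreover have "card (pverts T) = N" by (simp add: T_def)
  moreover have "\<forall>T :: nat pair_pre_digraph.
      tournament T \<and> card (pverts T) = N \<longrightarrow> contains_copy (with_proj D) (with_proj T)"
    unfolding N_def oriented_ramsey_def by (rule LeastI_ex) (rule oriented_ramsey_exists[OF D])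
  ultimately have "contains_copy (with_proj D) (with_proj T)" by blast
  moreover have "pair_wf_digraph D" "pair_wf_digraph T"
    using D(1) T by (simp_all add: pair_digraph_def pair_fin_digraph_def)
  ultimately obtain f where f: "inj_on f (pverts D)" "f ` pverts D \<subseteq> pverts T"
    "\<forall>(u, v) \<in> parcs D. (f u, f v) \<in> parcs T"
    using contains_copy_pair_iff by blast
  show False
  proof (rule no[of "e \<circ> f"])
    have "inj_on e (f ` pverts D)"
      using e f(2) by (auto simp: bij_betw_def T_def intro: inj_on_subset)
    then show "inj_on (e \<circ> f) (pverts D)" using f(1) by (rule comp_inj_on[rotated])
    show "(e \<circ> f) ` pverts D \<subseteq> W" using f(2) eW by (auto simp: T_def)
    show "((e \<circ> f) u, (e \<circ> f) v) \<in> Q" if "(u, v) \<in> parcs D" for u v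
      using f(3) that by (auto simp: T_def)
  qed
qed

section \<open>Tournaments without large transitive subtournaments\<close>

text \<open>A transitive subtournament is encoded as the list of its vertices in order, since
  \<open>sorted_wrt\<close> asks for every forward pair. Lists are what the union bound
  counts.\<close>

definition transitive_bound :: "'a set \<Rightarrow> 'a rel \<Rightarrow> nat \<Rightarrow> bool" where
  "transitive_bound B R L \<longleftrightarrow>
     (\<forall>xs. set xs \<subseteq> B \<and> distinct xs \<and> sorted_wrt (\<lambda>x y. (x, y) \<in> R) xs \<longrightarrow> length xs \<le> L)"

text \<open>Sorting \<open>S\<close> by an injective rank along which \<open>R\<close> points
  upwards lists it as a transitive subtournament.\<close>

lemma transitive_bound_card:
  fixes \<mu> :: "'a \<Rightarrow> nat"
  assumes "transitive_bound B R L" "S \<subseteq> B" "finite S" "inj_on \<mu> S"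
    and "\<And>x y. x \<in> S \<Longrightarrow> y \<in> S \<Longrightarrow> \<mu> x < \<mu> y \<Longrightarrow> (x, y) \<in> R"
  shows "card S \<le> L"
proof -
  obtain ys where ys: "set ys = S" "distinct ys"
    using finite_distinct_list[OF assms(3)] by blast
  let ?xs = "sort_key \<mu> ys"
  have "sorted (map \<mu> ?xs)" "distinct (map \<mu> ?xs)"
    using ys assms(4) by (auto simp: distinct_map)
  then have "sorted_wrt (<) (map \<mu> ?xs)" using strict_sorted_iff by blast
  then have "sorted_wrt (\<lambda>x y. \<mu> x < \<mu> y) ?xs" by (simp add: sorted_wrt_map)
  then have "sorted_wrt (\<lambda>x y. (x, y) \<in> R) ?xs"
    by (rule sorted_wrt_mono_rel[rotated]) (use assms(5) ys in auto)
  moreover have "set ?xs \<subseteq> B" "distinct ?xs" using assms(2) ys by simp_all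
  ultimately have "length ?xs \<le> L"
    using assms(1) unfolding transitive_bound_def by blast
  then show ?thesis using ys distinct_card by fastforce
qed

text \<open>Sets of pairs \<open>i < j\<close> code the labelled tournaments on
  \<open>{..<t}\<close>: a pair in \<open>E\<close> is oriented from the smaller to the larger
  number. Counting tournaments becomes counting subsets.\<close>

definition orientation :: "nat \<Rightarrow> nat rel \<Rightarrow> nat rel" where
  "orientation t E = {(i, j). i < t \<and> j < t \<and> (i < j \<and> (i, j) \<in> E \<or> j < i \<and> (j, i) \<notin> E)}"

lemma tournament_on_orientation: "tournament_on {..<t} (orientation t E)"
  by (auto simp: tournament_on_def orientation_def)

text \<open>The square of \<open>S\<close> splits into the diagonal, the increasing pairs and their
  converses.\<close>

lemma card_ordered_pairs:
  fixes S :: "'a::linorder set"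
  assumes "finite S"
  shows "card S + 2 * card {(i, j). i \<in> S \<and> j \<in> S \<and> i < j} = card S * card S"
proof -
  let ?Q = "{(i, j). i \<in> S \<and> j \<in> S \<and> i < j}"
  have finQ: "finite ?Q" by (rule finite_subset[of _ "S \<times> S"]) (use assms in auto)
  have "S \<times> S = Id_on S \<union> (?Q \<union> ?Q\<inverse>)" by (auto simp: Id_on_iff)
  then have "card (S \<times> S) = card (Id_on S \<union> (?Q \<union> ?Q\<inverse>))" by simp
  also have "\<dots> = card (Id_on S) + card (?Q \<union> ?Q\<inverse>)"
    by (rule card_Un_disjoint) (use finQ assms in \<open>auto simp: Id_on_def\<close>)
  also have "card (?Q \<union> ?Q\<inverse>) = card ?Q + card (?Q\<inverse>)"
    by (rule card_Un_disjoint) (use finQ in auto)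
  also have "card (Id_on S) = card S"
  proof -
    have "Id_on S = (\<lambda>x. (x, x)) ` S" by (auto simp: Id_on_def)
    then show ?thesis by (simp add: card_image inj_on_def)
  qed
  finally show ?thesis by (simp add: card_cartesian_product)
qed

text \<open>A fixed order on \<open>2 * s + 2\<close> vertices dictates \<open>E\<close> on all
  \<open>(s + 1) * (2 * s + 1)\<close> pairs among them, the set \<open>Q\<close>. Hence
  \<open>E\<close> is determined by \<open>E - Q\<close>.\<close>

lemma card_orientations_sorted:
  assumes xs: "set xs \<subseteq> {..<t}" "distinct xs" "length xs = 2 * s + 2"
  defines "P \<equiv> {(i, j). i < j \<and> j < t}"
  shows "card {E \<in> Pow P. sorted_wrt (\<lambda>x y. (x, y) \<in> orientation t E) xs} * 2 ^ ((s + 1) * (2 * s + 1))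
    \<le> 2 ^ card P"
proof -
  define Q where "Q = {(i, j). i \<in> set xs \<and> j \<in> set xs \<and> i < j}"
  let ?M = "{E \<in> Pow P. sorted_wrt (\<lambda>x y. (x, y) \<in> orientation t E) xs}"
  have finP: "finite P" by (rule finite_subset[of _ "{..<t} \<times> {..<t}"]) (auto simp: P_def)
  have QP: "Q \<subseteq> P" using xs(1) by (auto simp: Q_def P_def)
  have "card (set xs) = 2 * s + 2" using xs distinct_card by metis
  then have cQ: "card Q = (s + 1) * (2 * s + 1)"
    using card_ordered_pairs[of "set xs"] by (simp add: Q_def algebra_simps)
  have agree: "E \<inter> Q = E' \<inter> Q" if E: "E \<in> ?M" and E': "E' \<in> ?M" for E E'
  proof -
    have "(i, j) \<in> E \<longleftrightarrow> (i, j) \<in> E'" if ij: "(i, j) \<in> Q" for i j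
    proof -
      obtain a b where ab: "a < length xs" "xs ! a = i" "b < length xs" "xs ! b = j" "i < j"
        using ij by (auto simp: Q_def in_set_conv_nth)
      then consider "a < b" | "b < a" by fastforce
      then show ?thesis
      proof cases
        case 1
        then have "(i, j) \<in> orientation t E" "(i, j) \<in> orientation t E'"
          using E E' ab by (auto dest: sorted_wrt_nth_less)
        then show ?thesis using ab(5) by (auto simp: orientation_def)
      next
        case 2
        then have "(j, i) \<in> orientation t E" "(j, i) \<in> orientation t E'"
          using E E' ab by (auto dest: sorted_wrt_nth_less)
        then show ?thesis using ab(5) by (auto simp: orientation_def)
      qed
    qed
    then show ?thesis by auto
  qed
  have "inj_on (\<lambda>E. E - Q) ?M"
  proof (rule inj_onI)
    fix E E' assume "E \<in> ?M" "E' \<in> ?M" "E - Q = E' - Q"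
    with agree[of E E'] show "E = E'" by blast
  qed
  then have "card ?M \<le> card (Pow (P - Q))"
    by (rule card_inj_on_le) (use finP in auto)
  also have "\<dots> = 2 ^ (card P - card Q)"
    using finP QP by (simp add: card_Pow card_Diff_subset finite_subset)
  finally have "card ?M * 2 ^ card Q \<le> 2 ^ (card P - card Q) * 2 ^ card Q" by simp
  also have "\<dots> = 2 ^ card P"
    using card_mono[OF finP QP] by (simp flip: power_add)
  finally show ?thesis by (simp add: cQ)
qed

text \<open>The Erdos--Moser bound: a union bound over all possible transitive subtournaments.\<close>

lemma exists_tournament_transitive_bound:
  "\<exists>R. tournament_on {..<2 ^ s :: nat} R \<and> transitive_bound {..<2 ^ s} R (2 * s + 1)"
proof (rule ccontr)
  assume contra: "\<nexists>R. tournament_on {..<2 ^ s :: nat} R \<and> transitive_bound {..<2 ^ s} R (2 * s + 1)"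
  define t :: nat where "t = 2 ^ s"
  define P where "P = {(i, j). i < j \<and> j < t}"
  define q where "q = (s + 1) * (2 * s + 1)"
  define X where "X = {xs. set xs \<subseteq> {..<t} \<and> length xs = 2 * s + 2}"
  \<comment> \<open>Lists with repetitions get the empty set here, so \<open>X\<close> may count all
    \<open>t ^ (2 * s + 2)\<close> lists.\<close>
  define M where "M = (\<lambda>xs. {E \<in> Pow P. distinct xs \<and> sorted_wrt (\<lambda>x y. (x, y) \<in> orientation t E) xs})"
  have finP: "finite P" by (rule finite_subset[of _ "{..<t} \<times> {..<t}"]) (auto simp: P_def)
  have finX: "finite X" unfolding X_def by (rule finite_lists_length_eq) simp
  have cX: "card X = 2 ^ (s * (2 * s + 2))"
    unfolding X_def by (simp only: card_lists_length_eq finite_lessThan card_lessThan t_def power_mult)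
  have cM: "card (M xs) * 2 ^ q \<le> 2 ^ card P" if "xs \<in> X" for xs
    using card_orientations_sorted[of xs t s] that
    by (cases "distinct xs") (auto simp: M_def X_def P_def q_def)
  have "Pow P \<subseteq> (\<Union>xs\<in>X. M xs)"
  proof
    fix E assume E: "E \<in> Pow P"
    have "\<not> transitive_bound {..<t} (orientation t E) (2 * s + 1)"
      using contra tournament_on_orientation unfolding t_def by blast
    then obtain xs where xs: "set xs \<subseteq> {..<t}" "distinct xs"
      "sorted_wrt (\<lambda>x y. (x, y) \<in> orientation t E) xs" "2 * s + 2 \<le> length xs"
      unfolding transitive_bound_def by fastforce
    \<comment> \<open>A prefix of a transitive sequence is transitive, so one fixed length suffices
      for the union bound.\<close>
    let ?ys = "take (2 * s + 2) xs"
    have "set ?ys \<subseteq> {..<t}" using xs(1) set_take_subset by fastforce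
    then have "?ys \<in> X" using xs(4) by (simp add: X_def)
    moreover have "E \<in> M ?ys" using E xs by (simp add: M_def sorted_wrt_take)
    ultimately show "E \<in> (\<Union>xs\<in>X. M xs)" by blast
  qed
  then have "card (Pow P) \<le> card (\<Union>xs\<in>X. M xs)"
    by (rule card_mono[rotated]) (use finX finP in \<open>auto simp: M_def\<close>)
  also have "\<dots> \<le> (\<Sum>xs\<in>X. card (M xs))" by (rule card_UN_le[OF finX])
  finally have "2 ^ card P * 2 ^ q \<le> (\<Sum>xs\<in>X. card (M xs)) * (2 ^ q :: nat)"
    by (simp add: card_Pow finP)
  also have "\<dots> = (\<Sum>xs\<in>X. card (M xs) * 2 ^ q)" by (simp add: sum_distrib_right)
  also have "\<dots> \<le> card X * 2 ^ card P" using sum_bounded_above[of X, OF cM] by simp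
  finally have "(2 :: nat) ^ q \<le> 2 ^ (s * (2 * s + 2))" by (simp add: cX)
  then have "q \<le> s * (2 * s + 2)" by simp
  \<comment> \<open>\<open>q\<close> exceeds \<open>s * (2 * s + 2)\<close> by
    \<open>s + 1\<close>.\<close>
  then show False by (simp add: q_def algebra_simps)
qed

section \<open>Hubs in iterated blow-ups\<close>

text \<open>
  The common neighbour \<open>v\<close> of hubs \<open>a p, a q\<close> in one part of the blow-up must lie in that part too,
  so the edge from \<open>v\<close> to \<open>a r\<close> fixes the direction between the two parts. Hence the parts that
  contain at least two hubs form a transitive tournament, ordered by their first hubs.
\<close>

lemma card_hubs_le:
  fixes B :: "'a set" and a :: "nat \<Rightarrow> 'a list"
  assumes B: "finite B" "B \<noteq> {}" "tournament_on B R" "transitive_bound B R L"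
    and I: "finite I" "inj_on a I" "\<And>i. i \<in> I \<Longrightarrow> set (a i) \<subseteq> B \<and> length (a i) = K"
    and hub: "\<And>p q r. p \<in> I \<Longrightarrow> q \<in> I \<Longrightarrow> r \<in> I \<Longrightarrow> p < q \<Longrightarrow> p < r \<Longrightarrow>
      \<exists>v. set v \<subseteq> B \<and> (a p, v) \<in> lex R \<and> (v, a q) \<in> lex R \<and> (v, a r) \<in> lex R"
  shows "card I \<le> card B * (L + 1) ^ K"
  using I hub
proof (induction K arbitrary: a I)
  case 0
  have "a ` I \<subseteq> {[]}" using "0.prems"(3) by auto
  then have "card (a ` I) \<le> card {[] :: 'a list}" by (intro card_mono) auto
  then have "card I \<le> 1" using "0.prems"(2) by (simp add: card_image)
  also have "\<dots> \<le> card B" using B by (simp add: Suc_leI card_gt_0_iff)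
  finally show ?case by simp
next
  case (Suc K)
  \<comment> \<open>\<open>C x\<close> is the set of hubs in part \<open>x\<close> of the top level,
    and \<open>g\<close> is the inductive bound for one part.\<close>
  define C where "C = (\<lambda>x. {i \<in> I. hd (a i) = x})"
  define g where "g = card B * (L + 1) ^ K"
  define Big where "Big = {x \<in> B. 2 \<le> card (C x)}"
  have a_Cons: "a i = x # tl (a i)" "x \<in> B" "set (tl (a i)) \<subseteq> B" "length (tl (a i)) = K"
    if "i \<in> C x" for i x
    using that Suc.prems(3)[of i] by (cases "a i"; auto simp: C_def)+
  have finC: "finite (C x)" for x using Suc.prems(1) by (simp add: C_def)
  \<comment> \<open>The leaf lies between two words starting with \<open>x\<close>. Asymmetry of
    \<open>R\<close> forces its first letter to be \<open>x\<close> too, while the third hub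
    \<open>r\<close> may lie in any part.\<close>
  have witness: "\<exists>v. set v \<subseteq> B \<and> (tl (a p), v) \<in> lex R \<and> (v, tl (a q)) \<in> lex R \<and> (x # v, a r) \<in> lex R"
    if pqr: "p \<in> C x" "q \<in> C x" "r \<in> I" "p < q" "p < r" for p q r x
  proof -
    have "p \<in> I" "q \<in> I" using pqr by (auto simp: C_def)
    then obtain w where w: "set w \<subseteq> B" "(a p, w) \<in> lex R" "(w, a q) \<in> lex R" "(w, a r) \<in> lex R"
      using Suc.prems(4)[of p q r] pqr by blast
    obtain y v where yv: "w = y # v"
      using w(3) by (cases w) auto
    have "(x # tl (a p), y # v) \<in> lex R" "(y # v, x # tl (a q)) \<in> lex R"
      using w(2,3) a_Cons(1)[OF pqr(1)] a_Cons(1)[OF pqr(2)] yv by metis+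
    moreover have "y \<in> B" "x \<in> B" using w(1) yv a_Cons(2)[OF pqr(1)] by auto
    ultimately have "y = x" "(tl (a p), v) \<in> lex R" "(v, tl (a q)) \<in> lex R"
      using tournament_on_asym[OF B(3), of x y] tournament_on_irrefl[OF B(3), of x] by auto
    then show ?thesis using w yv by auto
  qed
  have C_le: "card (C x) \<le> g" for x
    unfolding g_def
  proof (rule Suc.IH[where a = "\<lambda>i. tl (a i)"])
    show "inj_on (\<lambda>i. tl (a i)) (C x)"
    proof (rule inj_onI)
      fix i j assume ij: "i \<in> C x" "j \<in> C x" "tl (a i) = tl (a j)"
      then have "a i = a j" by (metis a_Cons(1))
      then show "i = j" using ij Suc.prems(2) by (auto simp: C_def inj_on_def)
    qed
    show "\<exists>v. set v \<subseteq> B \<and> (tl (a p), v) \<in> lex R \<and> (v, tl (a q)) \<in> lex R \<and> (v, tl (a r)) \<in> lex R"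
      if pqr: "p \<in> C x" "q \<in> C x" "r \<in> C x" "p < q" "p < r" for p q r
    proof -
      have "r \<in> I" using pqr by (auto simp: C_def)
      then obtain v where v: "set v \<subseteq> B" "(tl (a p), v) \<in> lex R" "(v, tl (a q)) \<in> lex R" "(x # v, a r) \<in> lex R"
        using witness pqr by blast
      then have "(x # v, x # tl (a r)) \<in> lex R" using a_Cons(1)[OF pqr(3)] by metis
      moreover have "(x, x) \<notin> R" using tournament_on_irrefl[OF B(3) a_Cons(2)[OF pqr(1)]] .
      ultimately show ?thesis using v by auto
    qed
  qed (use finC a_Cons in auto)
  have "card Big \<le> L"
  proof (rule transitive_bound_card[OF B(4), where \<mu> = "\<lambda>x. Min (C x)"])
    show "Big \<subseteq> B" "finite Big" using B(1) by (auto simp: Big_def)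
    have ne: "C x \<noteq> {}" if "x \<in> Big" for x using that by (auto simp: Big_def)
    show "inj_on (\<lambda>x. Min (C x)) Big"
    proof (rule inj_onI)
      fix x y assume "x \<in> Big" "y \<in> Big" "Min (C x) = Min (C y)"
      then have "Min (C x) \<in> C x" "Min (C x) \<in> C y" using Min_in[OF finC] ne by metis+
      then show "x = y" by (auto simp: C_def)
    qed
    show "(x, y) \<in> R" if xy: "x \<in> Big" "y \<in> Big" "Min (C x) < Min (C y)" for x y
    proof -
      let ?p = "Min (C x)" and ?r = "Min (C y)"
      have p: "?p \<in> C x" and r: "?r \<in> C y" using Min_in[OF finC] ne xy by blast+
      \<comment> \<open>A second hub \<open>q\<close> after the first one traps the leaf in part
        \<open>x\<close>; its arc to the first hub of part \<open>y\<close> then shows the direction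
        between the parts.\<close>
      have "C x \<noteq> {?p}"
      proof
        assume "C x = {?p}"
        then have "card (C x) = card {?p}" by (rule arg_cong)
        then show False using xy(1) by (simp add: Big_def)
      qed
      then obtain q where q: "q \<in> C x" "q \<noteq> ?p" using p by blast
      then have "?p < q" using Min_le[OF finC q(1)] by simp
      moreover have "?r \<in> I" using r by (simp add: C_def)
      ultimately obtain v where "(x # v, a ?r) \<in> lex R"
        using witness[OF p q(1)] xy(3) by blast
      then have "(x # v, y # tl (a ?r)) \<in> lex R" using a_Cons(1)[OF r] by metis
      moreover have "x \<noteq> y" using xy(3) by auto
      ultimately show "(x, y) \<in> R" by auto
    qed
  qed
  have "hd (a i) \<in> B" if "i \<in> I" for i
    using a_Cons(2)[of i "hd (a i)"] that by (simp add: C_def)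
  then have "I = (\<Union>x\<in>B. C x)" by (auto simp: C_def)
  then have "card I \<le> (\<Sum>x\<in>B. card (C x))" using card_UN_le[OF B(1)] by metis
  \<comment> \<open>A part outside \<open>Big\<close> holds at most one hub; a part in
    \<open>Big\<close> holds at most \<open>g\<close>.\<close>
  also have "\<dots> \<le> (\<Sum>x\<in>B. 1 + (if x \<in> Big then g else 0))"
    by (rule sum_mono) (use C_le in \<open>auto simp: Big_def intro: le_SucI\<close>)
  also have "\<dots> = card B + card Big * g"
  proof -
    have "B \<inter> Big = Big" by (auto simp: Big_def)
    then show ?thesis unfolding sum.distrib using B(1) by (simp add: sum.If_cases)
  qed
  \<comment> \<open>\<open>card B \<le> g\<close> because \<open>(L + 1) ^ K\<close> is at least
    1.\<close>
  also have "\<dots> \<le> g + L * g"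
    using \<open>card Big \<le> L\<close> by (intro add_mono mult_right_mono) (auto simp: g_def)
  also have "\<dots> = card B * (L + 1) ^ Suc K" by (simp add: g_def algebra_simps)
  finally show ?case .
qed

section \<open>The hub digraph\<close>

text \<open>There are at most \<open>h ^ 3\<close> triples, so each gets its own leaf among the
  vertices from \<open>h\<close> on; leftover vertices stay isolated. A subgraph either has a vertex
  outside the hubs, of degree at most 3, or lies among the independent hubs.\<close>

lemma hub_digraph_exists:
  assumes "h ^ 3 + h \<le> n"
  shows "\<exists>D :: nat pair_pre_digraph. pair_digraph D \<and> acyclic (parcs D) \<and> pverts D = {..<n} \<and>
    degenerate 3 (with_proj (mk_symmetric (with_proj D))) \<and>
    (\<forall>i j k. i < j \<longrightarrow> i < k \<longrightarrow> j < h \<longrightarrow> k < h \<longrightarrow>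
       (\<exists>v<n. (i, v) \<in> parcs D \<and> (v, j) \<in> parcs D \<and> (v, k) \<in> parcs D))"
proof -
  define S where "S = {(i, j, k). i < j \<and> i < k \<and> j < h \<and> k < (h :: nat)}"
  have S_sub: "S \<subseteq> {..<h} \<times> {..<h} \<times> {..<h}" by (auto simp: S_def)
  have finS: "finite S" by (rule finite_subset[OF S_sub]) auto
  have "card S \<le> h ^ 3"
    using card_mono[OF _ S_sub] by (simp add: card_cartesian_product power3_eq_cube mult.assoc)
  then have "card S \<le> card {h..<n}" using assms by simp
  then obtain e where e: "e ` S \<subseteq> {h..<n}" "inj_on e S"
    using card_le_inj[OF finS, of "{h..<n}"] by blast
  have e_ge: "h \<le> e (i, j, k)" "e (i, j, k) < n" if "(i, j, k) \<in> S" for i j k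
    using e(1) that by auto
  define A where "A = (\<Union>(i, j, k)\<in>S. {(i, e (i, j, k)), (e (i, j, k), j), (e (i, j, k), k)})"
  define D where "D = \<lparr>pverts = {..<n}, parcs = A\<rparr>"
  \<comment> \<open>A topological rank: the leaf of \<open>(i, j, k)\<close> gets
    \<open>2 * i + 1\<close>, between hub \<open>i\<close> and the later hubs. At isolated vertices
    \<open>inv_into\<close> is unspecified, but no arc meets them.\<close>
  define \<rho> where "\<rho> = (\<lambda>x. if x < h then 2 * x else 2 * fst (inv_into S e x) + 1)"
  have rho: "\<rho> u < \<rho> v" if "(u, v) \<in> A" for u v
  proof -
    from that obtain i j k where s: "(i, j, k) \<in> S"
      and uv: "(u, v) = (i, e (i, j, k)) \<or> (u, v) = (e (i, j, k), j) \<or> (u, v) = (e (i, j, k), k)"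
      unfolding A_def by blast
    have "\<rho> (e (i, j, k)) = 2 * i + 1"
      using e_ge[OF s] inv_into_f_f[OF e(2) s] by (simp add: \<rho>_def)
    moreover have "\<rho> i = 2 * i" "\<rho> j = 2 * j" "\<rho> k = 2 * k" "i < j" "i < k"
      using s by (auto simp: \<rho>_def S_def)
    ultimately show ?thesis using uv by auto
  qed
  have "A \<subseteq> inv_image less_than \<rho>" using rho by auto
  then have acyc: "acyclic A"
    by (meson wf_acyclic wf_inv_image wf_less_than wf_subset)
  have A_V: "A \<subseteq> {..<n} \<times> {..<n}"
    using e_ge assms by (fastforce simp: A_def S_def)
  then have "finite A" by (rule finite_subset) simp
  then have D: "pair_digraph D"
    using A_V by unfold_locales (auto simp: D_def dest: rho)
  have deg: "degenerate 3 (with_proj (mk_symmetric (with_proj D)))"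
    unfolding degenerate_def
  proof (intro allI impI, elim conjE)
    fix H :: "(nat, nat \<times> nat) pre_digraph"
    assume H: "subgraph H (with_proj (mk_symmetric (with_proj D)))" and ne: "verts H \<noteq> {}"
    have H_arcs: "arcs H \<subseteq> A \<union> A\<inverse>" and H_tail: "tail H = fst" and H_head: "head H = snd"
      and wfH: "wf_digraph H"
      using H by (auto simp: subgraph_def compatible_def parcs_mk_symmetric D_def)
    show "\<exists>v\<in>verts H. out_degree H v \<le> 3"
    proof (cases "\<exists>v\<in>verts H. h \<le> v")
      case True
      then obtain v where v: "v \<in> verts H" "h \<le> v" by blast
      \<comment> \<open>If \<open>v\<close> is isolated, these values are unspecified, but then the
        claim about its neighbours is vacuous.\<close>
      define i j k where "i = fst (inv_into S e v)" and "j = fst (snd (inv_into S e v))"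
        and "k = snd (snd (inv_into S e v))"
      have "w \<in> {i, j, k}" if vw: "(v, w) \<in> A \<union> A\<inverse>" for w
      proof -
        from vw obtain i' j' k' where s: "(i', j', k') \<in> S"
          and "(v, w) = (i', e (i', j', k')) \<or> (v, w) = (e (i', j', k'), j') \<or> (v, w) = (e (i', j', k'), k')
            \<or> (w, v) = (i', e (i', j', k')) \<or> (w, v) = (e (i', j', k'), j') \<or> (w, v) = (e (i', j', k'), k')"
          unfolding A_def by blast
        moreover have "i' < h" "j' < h" "k' < h" using s by (auto simp: S_def)
        ultimately have "v = e (i', j', k')" "w \<in> {i', j', k'}" using v(2) by auto
        then show ?thesis using inv_into_f_f[OF e(2) s] by (simp add: i_def j_def k_def)
      qed
      then have "out_arcs H v \<subseteq> {(v, i), (v, j), (v, k)}"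
        using H_arcs by (fastforce simp: out_arcs_def H_tail)
      then have "out_degree H v \<le> card {(v, i), (v, j), (v, k)}"
        unfolding out_degree_def by (intro card_mono) auto
      also have "\<dots> \<le> 3" by (simp add: card_insert_if)
      finally show ?thesis using v by blast
    next
      case False
      \<comment> \<open>Every arc of \<open>A\<close> has a leaf as one end, so none joins two
        hubs.\<close>
      have "arcs H = {}"
      proof (rule ccontr)
        assume "arcs H \<noteq> {}"
        then obtain u w where uw: "(u, w) \<in> arcs H" by auto
        then have "u < h" "w < h"
          using False wf_digraph.tail_in_verts[OF wfH uw] wf_digraph.head_in_verts[OF wfH uw]
          by (auto simp: H_tail H_head not_le)
        moreover have "h \<le> u \<or> h \<le> w"
          using uw H_arcs e_ge by (fastforce simp: A_def)
        ultimately show False by auto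
      qed
      then show ?thesis using ne by (auto simp: out_degree_def out_arcs_def)
    qed
  qed
  have "\<exists>v<n. (i, v) \<in> parcs D \<and> (v, j) \<in> parcs D \<and> (v, k) \<in> parcs D"
    if "i < j" "i < k" "j < h" "k < h" for i j k
  proof -
    have s: "(i, j, k) \<in> S" using that by (simp add: S_def)
    then show ?thesis
      by (intro exI[of _ "e (i, j, k)"]) (use e_ge[OF s] in \<open>force simp: D_def A_def\<close>)
  qed
  then show ?thesis
    using D acyc deg by (intro exI[of _ D]) (simp add: D_def)
qed

text \<open>The host consists of the words of length \<open>K\<close> over \<open>2 ^ s\<close>
  letters. \<open>card_hubs_le\<close> with \<open>L = 2 * s + 1\<close> allows a copy fewer than
  \<open>h\<close> hubs, a contradiction.\<close>

lemma hub_digraph_ramsey: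
  assumes h: "h ^ 3 + h \<le> n" and large: "2 ^ s * (2 * s + 2) ^ K < h"
  shows "\<exists>D :: nat pair_pre_digraph. pair_digraph D \<and> acyclic (parcs D) \<and> card (pverts D) = n \<and>
    degenerate 3 (with_proj (mk_symmetric (with_proj D))) \<and> 2 ^ (s * K) < oriented_ramsey D"
proof -
  obtain D :: "nat pair_pre_digraph" where D: "pair_digraph D" "acyclic (parcs D)" "pverts D = {..<n}"
    "degenerate 3 (with_proj (mk_symmetric (with_proj D)))"
    and leaf: "\<And>i j k. i < j \<Longrightarrow> i < k \<Longrightarrow> j < h \<Longrightarrow> k < h \<Longrightarrow>
       \<exists>v<n. (i, v) \<in> parcs D \<and> (v, j) \<in> parcs D \<and> (v, k) \<in> parcs D"
    using hub_digraph_exists[OF h] by blast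
  define B :: "nat set" where "B = {..<2 ^ s}"
  obtain R where R: "tournament_on B R" "transitive_bound B R (2 * s + 1)"
    using exists_tournament_transitive_bound unfolding B_def by blast
  define W where "W = {xs. set xs \<subseteq> B \<and> length xs = K}"
  have "card W < oriented_ramsey D"
  proof (rule oriented_ramsey_greater[OF D(1,2)])
    show "finite W" unfolding W_def B_def by (rule finite_lists_length_eq) simp
    show "tournament_on W (lex R)" unfolding W_def by (rule tournament_on_lex[OF R(1)])
    fix f assume f: "inj_on f (pverts D)" "f ` pverts D \<subseteq> W"
      "\<And>u v. (u, v) \<in> parcs D \<Longrightarrow> (f u, f v) \<in> lex R"
    have "card {..<h} \<le> card B * (2 * s + 1 + 1) ^ K"
    proof (rule card_hubs_le[OF _ _ R, where a = f])
      show "finite B" by (simp add: B_def)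
      have "0 \<in> B" by (simp add: B_def)
      then show "B \<noteq> {}" by blast
      show "inj_on f {..<h}" using f(1) D(3) h by (auto intro: inj_on_subset)
      show "set (f i) \<subseteq> B \<and> length (f i) = K" if "i \<in> {..<h}" for i
      proof -
        have "i \<in> pverts D" using D(3) h that by simp
        then show ?thesis using f(2) by (auto simp: W_def)
      qed
      show "\<exists>v. set v \<subseteq> B \<and> (f p, v) \<in> lex R \<and> (v, f q) \<in> lex R \<and> (v, f r) \<in> lex R"
        if pqr: "q \<in> {..<h}" "r \<in> {..<h}" "p < q" "p < r" for p q r
      proof -
        obtain v where "v < n" "(p, v) \<in> parcs D" "(v, q) \<in> parcs D" "(v, r) \<in> parcs D"
          using leaf[of p q r] pqr by auto
        then show ?thesis using f(2,3) D(3) by (intro exI[of _ "f v"]) (auto simp: W_def)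
      qed
    qed simp
    then show False using large by (simp add: B_def)
  qed
  moreover have "card W = 2 ^ (s * K)"
    unfolding W_def by (simp add: card_lists_length_eq B_def power_mult)
  ultimately show ?thesis using D by auto
qed

section \<open>Choice of parameters and conclusion\<close>

text \<open>Both \<open>2 ^ s\<close> and \<open>(2 * s + 2) ^ K\<close> stay below
  \<open>n powr (1/8)\<close>, so an \<open>h\<close> just above \<open>n powr (1/4)\<close> beats
  their product, while \<open>h ^ 3 + h\<close> has order only \<open>n powr (3/4)\<close>.\<close>

lemma eventually_parameters:
  "\<forall>\<^sub>F n :: nat in sequentially. \<exists>s K h.
     h ^ 3 + h \<le> n \<and> 2 ^ s * (2 * s + 2) ^ K < h \<and>
     real n powr (1 / 512 * (ln (real n) / ln (ln (real n)))) \<le> real (2 ^ (s * K))"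
proof -
  \<comment> \<open>The first estimate fits the digraph into \<open>n\<close> vertices, the second
    gives \<open>2 * s + 2 \<le> ln n\<close>, and the next two absorb the loss from the floors by
    halving.\<close>
  have ev: "\<forall>\<^sub>F n :: nat in sequentially. (real n powr (1/4) + 1) ^ 3 + (real n powr (1/4) + 1) \<le> real n"
    "\<forall>\<^sub>F n :: nat in sequentially. 2 * (ln (real n) / 8) + 2 \<le> ln (real n)"
    "\<forall>\<^sub>F n :: nat in sequentially. ln (real n) / 16 \<le> ln (real n) / 8 - 1"
    "\<forall>\<^sub>F n :: nat in sequentially.
       ln (real n) / (16 * ln (ln (real n))) \<le> ln (real n) / (8 * ln (ln (real n))) - 1"
    "\<forall>\<^sub>F n :: nat in sequentially. 0 < ln (ln (real n))"
    "\<forall>\<^sub>F n :: nat in sequentially. 0 < ln (real n)"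
    by real_asymp+
  from ev eventually_gt_at_top[of 0] show ?thesis
  proof eventually_elim
    case (elim n)
    define l where "l = ln (real n)"
    define ll where "ll = ln l"
    have pos: "l > 0" "ll > 0" "n > 0" using elim by (simp_all add: l_def ll_def)
    define s where "s = nat \<lfloor>l / 8\<rfloor>"
    define K where "K = nat \<lfloor>l / (8 * ll)\<rfloor>"
    define h where "h = Suc (nat \<lfloor>real n powr (1/4)\<rfloor>)"
    have floor_bounds: "real (nat \<lfloor>x\<rfloor>) \<le> x" "x - 1 \<le> real (nat \<lfloor>x\<rfloor>)" if "x \<ge> 0" for x :: real
      using that by linarith+
    have s: "real s \<le> l / 8" "l / 16 \<le> real s"
      using floor_bounds[of "l / 8"] pos elim(3) unfolding s_def l_def by linarith+
    have K: "real K \<le> l / (8 * ll)" "l / (16 * ll) \<le> real K"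
    proof -
      have "0 \<le> l / (8 * ll)" using pos by simp
      then show "real K \<le> l / (8 * ll)" "l / (16 * ll) \<le> real K"
        using floor_bounds[of "l / (8 * ll)"] elim(4) unfolding K_def l_def ll_def by linarith+
    qed
    have h: "real n powr (1/4) < real h" "real h \<le> real n powr (1/4) + 1"
      unfolding h_def using floor_bounds(1)[of "real n powr (1/4)"] by (simp, linarith) (use floor_bounds(1)[of "real n powr (1/4)"] in simp)
    have "real (h ^ 3 + h) \<le> (real n powr (1/4) + 1) ^ 3 + (real n powr (1/4) + 1)"
      using h(2) by (auto intro!: add_mono power_mono)
    also have "\<dots> \<le> real n" by (rule elim(1))
    finally have size: "h ^ 3 + h \<le> n" by (simp only: of_nat_le_iff)
    have sl: "real (2 * s + 2) \<le> l" using s(1) elim(2) by (simp add: l_def)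
    have "(2 :: real) ^ s \<le> exp 1 ^ s" using exp_ge_add_one_self[of 1] by (intro power_mono) auto
    also have "\<dots> \<le> exp (l / 8)" using s(1) by (simp flip: exp_of_nat_mult)
    finally have base: "(2 :: real) ^ s \<le> exp (l / 8)" .
    have "real (2 * s + 2) ^ K \<le> l ^ K" using sl by (intro power_mono) auto
    also have "\<dots> = exp (real K * ll)" using pos by (simp add: exp_of_nat_mult ll_def)
    also have "\<dots> \<le> exp (l / 8)" using K(1) pos by (simp add: field_simps)
    finally have "real (2 ^ s * (2 * s + 2) ^ K) \<le> exp (l / 8) * exp (l / 8)"
      using mult_mono[OF base] by simp
    also have "\<dots> = real n powr (1/4)"
      using pos by (simp add: powr_def l_def flip: exp_add)
    also have "\<dots> < real h" by (rule h)
    finally have large: "2 ^ s * (2 * s + 2) ^ K < h" by (simp only: of_nat_less_iff)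
    \<comment> \<open>This is \<open>exp 1 \<le> 3 < 4\<close>.\<close>
    have ln2: "1 / 2 \<le> ln (2 :: real)"
    proof -
      have "1 \<le> ln (2 ^ 2 :: real)" using exp_le by (subst ln_ge_iff) auto
      then show ?thesis by (simp only: ln_realpow)
    qed
    \<comment> \<open>The constant is 512 = 16 * 16 * 2, from the lower bounds for \<open>s\<close>,
      \<open>K\<close> and \<open>ln 2\<close>.\<close>
    have "real n powr (1 / 512 * (l / ll)) = exp (l / 16 * (l / (16 * ll)) * (1 / 2))"
      using pos by (simp add: powr_def l_def field_simps)
    also have "\<dots> \<le> exp (real s * real K * ln 2)"
      unfolding exp_le_cancel_iff
      by (intro mult_mono s(2) K(2) ln2) (use pos in auto)
    also have "\<dots> = exp (real (s * K) * ln 2)" by simp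
    also have "\<dots> = real (2 ^ (s * K))" by (subst exp_of_nat_mult) simp
    finally have bound: "real n powr (1 / 512 * (l / ll)) \<le> real (2 ^ (s * K))" .
    show ?case
      using size large bound unfolding l_def ll_def by blast
  qed
qed

theorem theorem1p4:
  shows "\<exists>c :: real. c > 0 \<and>
    (\<forall>\<^sub>F n :: nat in sequentially.
      \<exists>D :: nat pair_pre_digraph.
        pair_digraph D \<and> acyclic (parcs D) \<and> card (pverts D) = n \<and>
        degenerate 3 (with_proj (mk_symmetric (with_proj D))) \<and>
        real (oriented_ramsey D) \<ge> real n powr (c * (ln (real n) / ln (ln (real n)))))"
proof (intro exI conjI)
  show "(1 / 512 :: real) > 0" by simp
  show "\<forall>\<^sub>F n :: nat in sequentially. \<exists>D :: nat pair_pre_digraph.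
        pair_digraph D \<and> acyclic (parcs D) \<and> card (pverts D) = n \<and>
        degenerate 3 (with_proj (mk_symmetric (with_proj D))) \<and>
        real (oriented_ramsey D) \<ge> real n powr (1 / 512 * (ln (real n) / ln (ln (real n))))"
    using eventually_parameters
  proof eventually_elim
    case (elim n)
    then obtain s K h where size: "h ^ 3 + h \<le> n" and large: "2 ^ s * (2 * s + 2) ^ K < h"
      and bound: "real n powr (1 / 512 * (ln (real n) / ln (ln (real n)))) \<le> real (2 ^ (s * K))"
      by blast
    obtain D :: "nat pair_pre_digraph" where D: "pair_digraph D" "acyclic (parcs D)" "card (pverts D) = n"
      "degenerate 3 (with_proj (mk_symmetric (with_proj D)))" and less: "2 ^ (s * K) < oriented_ramsey D"
      using hub_digraph_ramsey[OF size large] by blast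
    from less have "real (2 ^ (s * K)) \<le> real (oriented_ramsey D)"
      unfolding of_nat_le_iff by (rule less_imp_le)
    then show ?case
      using D order_trans[OF bound] by blast
  qed
qed

end
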